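(* For an integer $h\geq 1$ let $\Gamma_{2^h}$ denote the multiplicative circulant graph $MC(2^h)$. For every integer $h\geq 2$, $$diam(\Gamma_{2^h})=\begin{cases} diam(\Gamma_{2^{h-1}}) & \text{if } h \text{ is even},\\ diam(\Gamma_{2^{h-1}})+1 & \text{if } h \text{ is odd}.\end{cases}$$
   Context: For integers $m>1$, $h>0$, $MC(m^h)$ is the graph with vertex set $\mathbb{Z}_{m^h}$ in which distinct vertices $x,y$ are adjacent iff $x-y\equiv \pm m^i \pmod{m^h}$ for some $i\in\{0,\ldots,h-1\}$. $diam(\Gamma)$ is the maximum distance (shortest path length) between any pair of vertices of $\Gamma$. *)

theory Defs
  imports "Graph_Theory.Graph_Theory" "HOL-Number_Theory.Cong"
begin

text \<open>
  The multiplicative circulant graph \<open>MC(m^h)\<close>. The base \<open>m\<close> and the exponent \<open>h\<close> are separate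
  arguments because the number \<open>m^h\<close> does not determine them. The elements of \<open>\<int>\<^sub>n\<close>
  are represented by \<open>0, \<dots>, n - 1\<close>, and an undirected edge by its two opposite arcs.
\<close>

definition MC :: "nat \<Rightarrow> nat \<Rightarrow> int pair_pre_digraph" where
  "MC m h =
    \<lparr> pverts = {0..<int m ^ h},
      parcs = {(x, y). x \<in> {0..<int m ^ h} \<and> y \<in> {0..<int m ^ h} \<and> x \<noteq> y \<and>
        (\<exists>i<h. [x - y = int m ^ i] (mod int m ^ h) \<or> [x - y = - (int m ^ i)] (mod int m ^ h))} \<rparr>"

text \<open>
  With unit arc weights, \<^const>\<open>wf_digraph.\<mu>\<close> is the length of a shortest path
  (\<open>\<infinity>\<close> if there is none). It is only specified for well-formed graphs; see \<open>pair_graph_MC\<close>.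
\<close>

definition diam :: "('a, 'b) pre_digraph \<Rightarrow> ereal" where
  "diam G = (SUP (u, v) \<in> verts G \<times> verts G. wf_digraph.\<mu> G (\<lambda>_. 1) u v)"

lemma pair_graph_MC: "pair_graph (MC m h)"
proof -
  have sym: "[x - y = a] (mod n) \<longleftrightarrow> [y - x = - a] (mod n)" for x y a n :: int
    using cong_minus_minus_iff[of "x - y" a n] by simp
  have "finite (parcs (MC m h))"
    by (rule finite_subset[of _ "{0..<int m ^ h} \<times> {0..<int m ^ h}"]) (auto simp: MC_def)
  moreover have "symmetric (with_proj (MC m h))"
    unfolding symmetric_def with_proj_simps
  proof (rule symI)
    fix x y assume "(x, y) \<in> parcs (MC m h)"
    then show "(y, x) \<in> parcs (MC m h)"
      unfolding MC_def by (auto simp: sym[of x y])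
  qed
  ultimately show ?thesis
    by unfold_locales (auto simp: MC_def)
qed

text \<open>The diameters in question are finite, so that adding \<open>1\<close> is not absorbed by \<open>\<infinity>\<close>.\<close>

lemma diam_MC_less_infinity:
  assumes "m > 1" and "h > 0"
  shows "diam (with_proj (MC m h)) < \<infinity>"
proof -
  interpret pair_graph "MC m h" by (rule pair_graph_MC)
  let ?V = "pverts (MC m h)"
  have reach: "0 \<rightarrow>\<^sup>*\<^bsub>with_proj (MC m h)\<^esub> int k" if "int k \<in> ?V" for k
    using that
  proof (induction k)
    case 0
    then show ?case by simp
  next
    case (Suc k)
    then have "1 + int k < int m ^ h" by (simp add: MC_def)
    then have less: "int k < int m ^ h" by linarith
    then have k: "int k \<in> ?V" by (simp add: MC_def)
    have "(int k, int (Suc k)) \<in> parcs (MC m h)"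
      using Suc.prems assms less by (auto simp: MC_def intro!: exI[of _ 0])
    with Suc.IH[OF k] show ?case by (rule reachable_adj_trans)
  qed
  have "\<mu> (\<lambda>_. 1) u v < \<infinity>" if "u \<in> ?V" "v \<in> ?V" for u v
  proof -
    have "0 \<rightarrow>\<^sup>*\<^bsub>with_proj (MC m h)\<^esub> u" "0 \<rightarrow>\<^sup>*\<^bsub>with_proj (MC m h)\<^esub> v"
      using reach[of "nat u"] reach[of "nat v"] that by (auto simp: MC_def)
    then have "u \<rightarrow>\<^sup>*\<^bsub>with_proj (MC m h)\<^esub> v"
      by (metis symmetric_reachable' reachable_trans)
    then show ?thesis using \<mu>_reach_conv by blast
  qed
  moreover have "finite (?V \<times> ?V)" by (simp add: MC_def)
  moreover have "?V \<times> ?V \<noteq> {}" using assms by (simp add: MC_def)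
  ultimately show ?thesis
    unfolding diam_def with_proj_simps by (subst finite_Sup_less_iff) auto
qed

end

theory Submission
  imports Defs
begin

text \<open>
  A walk of length \<open>n\<close> in \<open>MC(m^h)\<close> from \<open>u\<close> to \<open>v\<close> amounts to writing \<open>u - v\<close> modulo \<open>m^h\<close> as
  \<open>\<Sum>i<h. c\<^sub>i m^i\<close> with integer digits of total size \<open>\<Sum>i<h. \<bar>c\<^sub>i\<bar> \<le> n\<close>. For \<open>m = 2\<close> the diameter is
  \<open>\<lceil>h/2\<rceil>\<close>. Every residue class modulo 4 contains one of \<open>0, 1, 2, -1\<close>, so two digit positions can
  be cleared at the cost of one summand. Conversely the number \<open>\<dots>010101\<close> in binary needs a summand
  for every two positions: the total size of the lowest two digits exceeds by at least 1 the size
  of the carry that they produce.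
\<close>

section \<open>Walks in \<open>MC m h\<close> and digit expansions in base \<open>m\<close>\<close>

lemma sum_digits_update:
  fixes c :: "nat \<Rightarrow> int"
  assumes "j < h"
  shows "(\<Sum>i<h. (c(j := c j + s)) i * b ^ i) = (\<Sum>i<h. c i * b ^ i) + s * b ^ j"
proof -
  have "(\<Sum>i<h. (c(j := c j + s)) i * b ^ i) = (\<Sum>i<h. c i * b ^ i + (if i = j then s * b ^ j else 0))"
    by (intro sum.cong) (auto simp: algebra_simps)
  with assms show ?thesis by (simp add: sum.distrib)
qed

lemma sum_abs_update:
  fixes c :: "nat \<Rightarrow> int"
  assumes "j < h"
  shows "(\<Sum>i<h. \<bar>(c(j := x)) i\<bar>) = (\<Sum>i<h. \<bar>c i\<bar>) - \<bar>c j\<bar> + \<bar>x\<bar>"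
proof -
  have "(\<Sum>i<h. \<bar>(c(j := x)) i\<bar>) = (\<Sum>i<h. \<bar>c i\<bar> + (if i = j then \<bar>x\<bar> - \<bar>c j\<bar> else 0))"
    by (intro sum.cong) auto
  with assms show ?thesis by (simp add: sum.distrib)
qed

lemma (in wf_digraph) awalk_cost_1: "awalk_cost (\<lambda>_. 1) p = real (length p)"
  by (induction p) auto

text \<open>Each arc adds 1 or -1 to a single digit, so the digits count the signed uses of each
  power of \<open>m\<close>. Only an inequality results, since opposite steps at the same position
  cancel.\<close>

lemma digits_of_awalk_MC:
  assumes "pre_digraph.awalk (with_proj (MC m h)) u p v"
  shows "\<exists>c :: nat \<Rightarrow> int. [(\<Sum>i<h. c i * int m ^ i) = u - v] (mod int m ^ h) \<and>
    (\<Sum>i<h. \<bar>c i\<bar>) \<le> int (length p)"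
proof -
  interpret pair_graph "MC m h" by (rule pair_graph_MC)
  show ?thesis
    using assms
  proof (induction p arbitrary: u)
    case Nil
    then show ?case by (intro exI[of _ "\<lambda>_. 0"]) (auto simp: awalk_simps)
  next
    case (Cons e p)
    obtain w where e: "e = (u, w)" "(u, w) \<in> parcs (MC m h)" "awalk w p v"
      using Cons.prems by (cases e) (auto simp: awalk_simps)
    from Cons.IH[OF e(3)] obtain c :: "nat \<Rightarrow> int"
      where c: "[(\<Sum>i<h. c i * int m ^ i) = w - v] (mod int m ^ h)"
        "(\<Sum>i<h. \<bar>c i\<bar>) \<le> int (length p)"
      by blast
    from e(2) obtain j s where j: "j < h" "\<bar>s :: int\<bar> = 1"
      "[u - w = s * int m ^ j] (mod int m ^ h)"
      unfolding MC_def by (auto intro: that[of _ 1] that[of _ "-1"])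
    have "[(\<Sum>i<h. c i * int m ^ i) + s * int m ^ j = (w - v) + (u - w)] (mod int m ^ h)"
      using c(1) j(3) by (intro cong_add) (auto simp: cong_sym_eq)
    then show ?case
      using c(2) j(1,2)
      by (intro exI[of _ "c(j := c j + s)"])
        (auto simp: sum_digits_update sum_abs_update simp del: fun_upd_apply)
  qed
qed

text \<open>The expansion is spent one unit at a time: each step of the walk moves one nonzero digit
  closer to 0.\<close>

lemma awalk_MC_of_digits:
  fixes c :: "nat \<Rightarrow> int"
  assumes "u \<in> pverts (MC m h)" "v \<in> pverts (MC m h)"
    and "[(\<Sum>i<h. c i * int m ^ i) = u - v] (mod int m ^ h)"
    and "(\<Sum>i<h. \<bar>c i\<bar>) \<le> int n"
  shows "\<exists>p. pre_digraph.awalk (with_proj (MC m h)) u p v \<and> length p \<le> n"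
proof -
  interpret pair_graph "MC m h" by (rule pair_graph_MC)
  show ?thesis
    using assms
  proof (induction n arbitrary: u c)
    case 0
    have "(\<Sum>i<h. \<bar>c i\<bar>) = 0"
      using 0(4) by (intro antisym sum_nonneg) auto
    then have "\<forall>i<h. c i = 0" by (auto simp: sum_nonneg_eq_0_iff)
    then have "[0 = u - v] (mod int m ^ h)" using 0(3) by simp
    then have "[u = v] (mod int m ^ h)" by (simp add: cong_iff_dvd_diff dvd_diff_commute)
    then have "u = v" using 0(1,2) by (auto simp: MC_def cong_def)
    with 0 show ?case by (auto simp: awalk_simps)
  next
    case (Suc n)
    show ?case
    \<comment> \<open>The bound on the digits need not be sharp, so no unit may be left to
      spend.\<close>
    proof (cases "\<forall>j<h. c j = 0")
      case True
      then have "(\<Sum>i<h. \<bar>c i\<bar>) \<le> int n" by simp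
      from Suc.IH[OF Suc.prems(1-3) this] show ?thesis by (auto intro: le_SucI)
    next
      case False
      then obtain j where j: "j < h" "c j \<noteq> 0" by blast
      define s where "s = sgn (c j)"
      have s: "\<bar>c j + - s\<bar> = \<bar>c j\<bar> - 1" "s = 1 \<or> s = - 1"
        using j(2) by (auto simp: s_def sgn_if)
      define w where "w = (u - s * int m ^ j) mod int m ^ h"
      have "0 \<le> u" "u < int m ^ h" using Suc.prems(1) by (simp_all add: MC_def)
      then have "0 < int m ^ h" by (rule le_less_trans)
      then have w: "w \<in> pverts (MC m h)" by (simp add: w_def MC_def)
      have cw: "[w = u - s * int m ^ j] (mod int m ^ h)" by (simp add: w_def)
      have "[(\<Sum>i<h. c i * int m ^ i) + - s * int m ^ j = (u - v) + - s * int m ^ j] (mod int m ^ h)"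
        using Suc.prems(3) by (intro cong_add) auto
      moreover have "[w - v = (u - s * int m ^ j) - v] (mod int m ^ h)"
        using cw by (intro cong_diff) auto
      ultimately have "[(\<Sum>i<h. (c(j := c j + - s)) i * int m ^ i) = w - v] (mod int m ^ h)"
        unfolding sum_digits_update[OF j(1)]
        by (simp add: cong_def algebra_simps)
      moreover have "(\<Sum>i<h. \<bar>(c(j := c j + - s)) i\<bar>) \<le> int n"
        unfolding sum_abs_update[OF j(1)] using Suc.prems(4) s(1) by simp
      ultimately obtain p where p: "awalk w p v" "length p \<le> n"
        using Suc.IH[OF w Suc.prems(2)] by blast
      show ?thesis
      \<comment> \<open>Arcs join distinct vertices only. For \<open>m = 1\<close> the step leads
        back to \<open>u\<close> and is dropped, which the bound on the length permits.\<close>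
      proof (cases "u = w")
        case True
        with p show ?thesis by (auto intro: le_SucI)
      next
        case False
        have "[u - w = u - (u - s * int m ^ j)] (mod int m ^ h)"
          using cw by (intro cong_diff) auto
        then have "[u - w = s * int m ^ j] (mod int m ^ h)" by simp
        then have "(u, w) \<in> parcs (MC m h)"
          using s(2) j(1) False w Suc.prems(1) by (auto simp: MC_def)
        then show ?thesis using p by (intro exI[of _ "(u, w) # p"]) (auto simp: awalk_simps)
      qed
    qed
  qed
qed

text \<open>Distances depend only on the difference of two vertices. So the lower bound needs just
  one residue \<open>x\<close> that is expensive to represent; the pair
  \<open>x mod int m ^ h\<close> and \<open>0\<close> then attains the diameter.\<close>

lemma diam_MC_eqI:
  assumes "m > 0"
    and le: "\<And>x. \<exists>c :: nat \<Rightarrow> int. [(\<Sum>i<h. c i * int m ^ i) = x] (mod int m ^ h) \<and>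
      (\<Sum>i<h. \<bar>c i\<bar>) \<le> int d"
    and ge: "\<And>c :: nat \<Rightarrow> int. [(\<Sum>i<h. c i * int m ^ i) = x] (mod int m ^ h) \<Longrightarrow>
      int d \<le> (\<Sum>i<h. \<bar>c i\<bar>)"
  shows "diam (with_proj (MC m h)) = ereal (real d)"
proof -
  interpret pair_graph "MC m h" by (rule pair_graph_MC)
  let ?V = "pverts (MC m h)"
  have "\<mu> (\<lambda>_. 1) u v \<le> ereal (real d)" if uv: "u \<in> ?V" "v \<in> ?V" for u v
  proof -
    obtain p where "awalk u p v" "length p \<le> d"
      using awalk_MC_of_digits[OF uv] le[of "u - v"] by blast
    then show ?thesis
      using min_cost_le_walk_cost[of u p v "\<lambda>_. 1"] unfolding awalk_cost_1
      by (auto elim: order_trans)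
  qed
  moreover have "ereal (real d) \<le> \<mu> (\<lambda>_. 1) (x mod int m ^ h) 0"
    unfolding \<mu>_def
  proof (rule INF_greatest)
    fix p assume "p \<in> {p. awalk (x mod int m ^ h) p 0}"
    then obtain c :: "nat \<Rightarrow> int"
      where "[(\<Sum>i<h. c i * int m ^ i) = x mod int m ^ h - 0] (mod int m ^ h)"
        "(\<Sum>i<h. \<bar>c i\<bar>) \<le> int (length p)"
      using digits_of_awalk_MC by blast
    then show "ereal (real d) \<le> ereal (awalk_cost (\<lambda>_. 1) p)"
      using ge[of c] unfolding awalk_cost_1 by (simp add: cong_def)
  qed
  moreover have "x mod int m ^ h \<in> ?V" "0 \<in> ?V" using assms(1) by (auto simp: MC_def)
  ultimately show ?thesis
    unfolding diam_def with_proj_simps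
    by (intro antisym SUP_least SUP_upper2[of "(x mod int m ^ h, 0)"]) auto
qed

section \<open>Binary expansions: bounds on the total digit size\<close>

lemma sum_lessThan_Suc_Suc_shift:
  fixes f :: "nat \<Rightarrow> int"
  shows "(\<Sum>i<Suc (Suc h). f i) = f 0 + f 1 + (\<Sum>i<h. f (i + 2))"
  by (simp only: sum.lessThan_Suc_shift) simp

lemma binary_digits_shift:
  fixes c :: "nat \<Rightarrow> int"
  shows "(\<Sum>i<Suc (Suc h). c i * 2 ^ i) = c 0 + 2 * c 1 + 4 * (\<Sum>i<h. c (i + 2) * 2 ^ i)"
  unfolding sum_lessThan_Suc_Suc_shift by (simp add: sum_distrib_left algebra_simps)

lemma ex_binary_digits_le:
  "\<exists>c :: nat \<Rightarrow> int. [(\<Sum>i<h. c i * 2 ^ i) = x] (mod 2 ^ h) \<and> (\<Sum>i<h. \<bar>c i\<bar>) \<le> int ((h + 1) div 2)"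
proof (induction h arbitrary: x rule: induct_nat_012)
  case 0
  then show ?case by simp
next
  case 1
  have "\<bar>x mod 2\<bar> \<le> 1" by simp
  then show ?case by (intro exI[of _ "\<lambda>_. x mod 2"]) simp
next
  case (ge2 h)
  have "\<exists>a b y :: int. x = a + 2 * b + 4 * y \<and> \<bar>a\<bar> + \<bar>b\<bar> \<le> 1"
  proof -
    consider "x mod 4 = 0" | "x mod 4 = 1" | "x mod 4 = 2" | "x mod 4 = 3"
      by fastforce
    then show ?thesis
    proof cases
      case 1
      then have "x = 0 + 2 * 0 + 4 * (x div 4)" by presburger
      then show ?thesis by (metis abs_0 add_0 zero_le_one)
    next
      case 2
      then have "x = 1 + 2 * 0 + 4 * (x div 4)" by presburger
      then show ?thesis by (metis abs_0 abs_1 add.right_neutral order_refl)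
    next
      case 3
      then have "x = 0 + 2 * 1 + 4 * (x div 4)" by presburger
      then show ?thesis by (metis abs_0 abs_1 add_0 order_refl)
    next
      \<comment> \<open>Writing 3 as \<open>1 + 2\<close> would cost two units; \<open>- 1\<close>
        costs one and carries 1 into the quotient.\<close>
      case 4
      then have "x = - 1 + 2 * 0 + 4 * (x div 4 + 1)" by presburger
      then show ?thesis by (metis abs_0 abs_1 abs_minus_cancel add.right_neutral order_refl)
    qed
  qed
  then obtain a b y :: int where x: "x = a + 2 * b + 4 * y" and ab: "\<bar>a\<bar> + \<bar>b\<bar> \<le> 1"
    by blast
  obtain c :: "nat \<Rightarrow> int" where c: "[(\<Sum>i<h. c i * 2 ^ i) = y] (mod 2 ^ h)"
    "(\<Sum>i<h. \<bar>c i\<bar>) \<le> int ((h + 1) div 2)"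
    using ge2.IH(1) by blast
  let ?c = "\<lambda>i. if i = 0 then a else if i = 1 then b else c (i - 2)"
  have "[4 * (\<Sum>i<h. c i * 2 ^ i) = 4 * y] (mod 4 * 2 ^ h)"
    using c(1) by (simp add: cong_cmult_leftI)
  then have "[a + 2 * b + 4 * (\<Sum>i<h. c i * 2 ^ i) = x] (mod 2 ^ Suc (Suc h))"
    unfolding x by (intro cong_add) (simp_all add: mult.assoc)
  then have "[(\<Sum>i<Suc (Suc h). ?c i * 2 ^ i) = x] (mod 2 ^ Suc (Suc h))"
    unfolding binary_digits_shift by simp
  moreover have "(\<Sum>i<Suc (Suc h). \<bar>?c i\<bar>) \<le> int ((Suc (Suc h) + 1) div 2)"
    unfolding sum_lessThan_Suc_Suc_shift using ab c(2) by simp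
  ultimately show ?case by (intro exI[of _ ?c] conjI)
qed

text \<open>The equation gives \<open>4 * \<bar>t\<bar> \<le> \<bar>a\<bar> + 2 * \<bar>b\<bar> +
  1\<close>. As \<open>a\<close> is odd, this suffices unless \<open>\<bar>a\<bar> = 1\<close> and
  \<open>b = 0\<close>; then divisibility by 4 forces \<open>a = 1\<close> and
  \<open>t = 0\<close>.\<close>

lemma carry_less_digits:
  fixes a b t :: int
  assumes "a + 2 * b = 1 + 4 * t"
  shows "\<bar>t\<bar> + 1 \<le> \<bar>a\<bar> + \<bar>b\<bar>"
  using assms by arith

text \<open>The witness is 1 for one or two positions, and \<open>1 + 4 * x\<close> after two more
  positions, which appends the binary digits 01.\<close>

lemma ex_binary_digits_ge:
  "\<exists>x :: int. \<forall>c :: nat \<Rightarrow> int. [(\<Sum>i<Suc h. c i * 2 ^ i) = x] (mod 2 ^ Suc h) \<longrightarrow>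
    int ((Suc h + 1) div 2) \<le> (\<Sum>i<Suc h. \<bar>c i\<bar>)"
proof (induction h rule: induct_nat_012)
  case 0
  have "1 \<le> \<bar>a\<bar>" if "[a = 1] (mod 2)" for a :: int
    using that by (cases "a = 0") (auto simp: cong_def)
  then show ?case by (intro exI[of _ 1]) auto
next
  case 1
  have "1 \<le> \<bar>a\<bar> + \<bar>b\<bar>" if "[a + b * 2 = 1] (mod 4)" for a b :: int
    using that by (cases "a = 0 \<and> b = 0") (auto simp: cong_def)
  then show ?case by (intro exI[of _ 1]) auto
next
  case (ge2 h)
  then obtain x :: int where x: "\<And>c :: nat \<Rightarrow> int.
    [(\<Sum>i<Suc h. c i * 2 ^ i) = x] (mod 2 ^ Suc h) \<Longrightarrow> int ((Suc h + 1) div 2) \<le> (\<Sum>i<Suc h. \<bar>c i\<bar>)"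
    by blast
  have "int ((Suc (Suc (Suc h)) + 1) div 2) \<le> (\<Sum>i<Suc (Suc (Suc h)). \<bar>c i\<bar>)"
    if c: "[(\<Sum>i<Suc (Suc (Suc h)). c i * 2 ^ i) = 1 + 4 * x] (mod 2 ^ Suc (Suc (Suc h)))"
    for c :: "nat \<Rightarrow> int"
  proof -
    define d where "d i = c (i + 2)" for i
    let ?S = "\<Sum>i<Suc h. d i * 2 ^ i"
    have "[c 0 + 2 * c 1 + 4 * ?S = 1 + 4 * x] (mod 4 * 2 ^ Suc h)"
      using c unfolding binary_digits_shift d_def by (simp add: mult.assoc)
    then obtain q where q: "c 0 + 2 * c 1 + 4 * ?S - (1 + 4 * x) = 4 * 2 ^ Suc h * q"
      unfolding cong_iff_dvd_diff by (auto elim: dvdE)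
    \<comment> \<open>\<open>t\<close> is the carry out of the lowest two positions. Including the
      multiple of the modulus turns the congruence into an exact equation, as
      \<open>carry_less_digits\<close> requires.\<close>
    define t where "t = x - ?S + 2 ^ Suc h * q"
    have t: "c 0 + 2 * c 1 = 1 + 4 * t" using q unfolding t_def by (simp add: algebra_simps)
    \<comment> \<open>Adding the carry to the lowest remaining digit represents \<open>x\<close>, at
      an extra cost of at most \<open>\<bar>t\<bar>\<close>. The two removed digits pay for this and
      for one more unit.\<close>
    have "(\<Sum>i<Suc h. (d(0 := d 0 + t)) i * 2 ^ i) = ?S + t"
      using sum_digits_update[of 0 "Suc h" d t 2] by simp
    also have "\<dots> = x + 2 ^ Suc h * q" unfolding t_def by simp
    finally have "[(\<Sum>i<Suc h. (d(0 := d 0 + t)) i * 2 ^ i) = x] (mod 2 ^ Suc h)"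
      by (simp add: cong_iff_dvd_diff)
    then have "int ((Suc h + 1) div 2) \<le> (\<Sum>i<Suc h. \<bar>(d(0 := d 0 + t)) i\<bar>)" by (rule x)
    also have "\<dots> \<le> (\<Sum>i<Suc h. \<bar>d i\<bar>) + \<bar>t\<bar>"
      unfolding sum_abs_update[OF zero_less_Suc] by simp
    finally have "int ((Suc h + 1) div 2) \<le> (\<Sum>i<Suc h. \<bar>d i\<bar>) + \<bar>t\<bar>" .
    with carry_less_digits[OF t] show ?thesis
      unfolding sum_lessThan_Suc_Suc_shift[of _ "Suc h"] d_def by simp
  qed
  then show ?case by blast
qed

section \<open>The diameter for base 2\<close>

lemma diam_MC_2: "diam (with_proj (MC 2 (Suc h))) = ereal (real ((Suc h + 1) div 2))"
proof -
  obtain x :: int where "\<And>c :: nat \<Rightarrow> int. [(\<Sum>i<Suc h. c i * 2 ^ i) = x] (mod 2 ^ Suc h) \<Longrightarrow>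
    int ((Suc h + 1) div 2) \<le> (\<Sum>i<Suc h. \<bar>c i\<bar>)"
    using ex_binary_digits_ge by blast
  then show ?thesis
    using ex_binary_digits_le[of "Suc h"] by (intro diam_MC_eqI[of _ _ _ x]) simp_all
qed

theorem theorem3p8:
  fixes h :: nat
  assumes "h \<ge> 2"
  shows "diam (with_proj (MC 2 h)) =
    (if even h then diam (with_proj (MC 2 (h - 1))) else diam (with_proj (MC 2 (h - 1))) + 1)"
proof -
  \<comment> \<open>This makes both \<open>h\<close> and \<open>h - 1\<close> successors, as in
    \<open>diam_MC_2\<close>. The claim is then that \<open>(h + 1) div 2\<close> exceeds
    \<open>h div 2\<close> by 1 for odd \<open>h\<close> and equals it for even
    \<open>h\<close>.\<close>
  obtain k where k: "h = Suc (Suc k)"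
    using assms by (metis Suc_le_D numeral_2_eq_2 Suc_le_mono)
  show ?thesis
    unfolding k by (auto simp: diam_MC_2 elim!: evenE oddE)
qed

end
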